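(* Let $M\in\mathbb{R}^{d\times n}$ be a matrix. Then the tropical rank of $M$ is equal to one plus the dimension of the tropical convex hull of the columns of $M$, viewed as a tropical polytope in $\mathbb{TP}^{d-1}$.
   Context: The tropical semiring is $(\mathbb{R},\oplus,\odot)$ with $a\oplus b=\min(a,b)$, $a\odot b=a+b$. A square matrix $(m_{ij})\in\mathbb{R}^{r\times r}$ is tropically singular if $\min_{\sigma\in\mathcal{S}_r}(m_{1\sigma_1}+\cdots+m_{r\sigma_r})$ is attained by at least two permutations $\sigma$; otherwise it is tropically non-singular. The tropical rank of $M$ is the largest $r$ such that $M$ has a tropically non-singular $r\times r$ submatrix. $\mathbb{TP}^{d-1}=\mathbb{R}^d/\mathbb{R}(1,\dots,1)$. The tropical convex hull of $v_1,\dots,v_n\in\mathbb{R}^d$ is the image in $\mathbb{TP}^{d-1}$ of the set of all tropical linear combinations $a_1\odot v_1\oplus\cdots\oplus a_n\odot v_n$, $a_i\in\mathbb{R}$ (where $a\odot v$ adds $a$ to every coordinate of $v$ and $\oplus$ is coordinatewise minimum). It is a finite union of bounded convex polyhedra in $\mathbb{TP}^{d-1}\cong\mathbb{R}^{d-1}$ (a bounded polyhedral complex); its dimension is its dimension as such, i.e. the maximal dimension of a polyhedron contained in it. *)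

theory Defs
  imports "HOL-Analysis.Analysis"
begin

section \<open>Tropical rank\<close>

text \<open>Only the entries \<open>A i k\<close> with \<open>i, k < r\<close> are relevant, and \<open>Min\<close> below ranges over all
  permutations of \<open>{..<r}\<close>, a finite nonempty set.\<close>

definition trop_singular :: "nat \<Rightarrow> (nat \<Rightarrow> nat \<Rightarrow> real) \<Rightarrow> bool" where
  "trop_singular r A \<longleftrightarrow>
     (let weight = (\<lambda>\<sigma>. \<Sum>i<r. A i (\<sigma> i));
          m = Min (weight ` {\<sigma>. \<sigma> permutes {..<r}})
      in \<exists>\<sigma> \<tau>. \<sigma> permutes {..<r} \<and> \<tau> permutes {..<r} \<and> \<sigma> \<noteq> \<tau> \<and> weight \<sigma> = m \<and> weight \<tau> = m)"

text \<open>An \<open>r \<times> r\<close> submatrix is given by injective choices \<open>f\<close> of rows and \<open>g\<close> of columns. The index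
  types carry no order; reordering rows or columns does not affect singularity.\<close>

definition trop_rank :: "real ^ 'n ^ 'd \<Rightarrow> nat" where
  "trop_rank M = Max {r. \<exists>(f :: nat \<Rightarrow> 'd) (g :: nat \<Rightarrow> 'n).
     inj_on f {..<r} \<and> inj_on g {..<r} \<and> \<not> trop_singular r (\<lambda>i k. M $ f i $ g k)}"


section \<open>Tropical projective space as a quotient vector space\<close>

definition tp_rel :: "real ^ 'd \<Rightarrow> real ^ 'd \<Rightarrow> bool" where
  "tp_rel x y \<longleftrightarrow> (\<exists>c. x - y = c *\<^sub>R (\<chi> i. 1))"

lemma equivp_tp_rel: "equivp (tp_rel :: real ^ 'd \<Rightarrow> real ^ 'd \<Rightarrow> bool)"
proof (rule equivpI)
  show "reflp (tp_rel :: real ^ 'd \<Rightarrow> _)"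
    by (rule reflpI) (auto simp: tp_rel_def intro: exI[of _ 0])
  show "symp (tp_rel :: real ^ 'd \<Rightarrow> _)"
  proof (rule sympI)
    fix x y :: "real ^ 'd" assume "tp_rel x y"
    then obtain c where "x - y = c *\<^sub>R (\<chi> i. 1)" by (auto simp: tp_rel_def)
    then have "y - x = (- c) *\<^sub>R (\<chi> i. 1)" by (simp add: vec_eq_iff algebra_simps)
    then show "tp_rel y x" unfolding tp_rel_def by blast
  qed
  show "transp (tp_rel :: real ^ 'd \<Rightarrow> _)"
  proof (rule transpI)
    fix x y z :: "real ^ 'd" assume "tp_rel x y" "tp_rel y z"
    then obtain c e where "x - y = c *\<^sub>R (\<chi> i. 1)" "y - z = e *\<^sub>R (\<chi> i. 1)"
      by (auto simp: tp_rel_def)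
    then have "x - z = (c + e) *\<^sub>R (\<chi> i. 1)"
      by (simp add: vec_eq_iff algebra_simps)
    then show "tp_rel x z" unfolding tp_rel_def by blast
  qed
qed

quotient_type 'd tp = "real ^ 'd::finite" / tp_rel
  by (rule equivp_tp_rel)

instantiation tp :: (finite) real_vector
begin

lift_definition zero_tp :: "'a tp" is 0 .

lift_definition plus_tp :: "'a tp \<Rightarrow> 'a tp \<Rightarrow> 'a tp" is "(+)"
  unfolding tp_rel_def
proof (elim exE)
  fix x x' y y' :: "real ^ 'a" and c e
  assume "x - x' = c *\<^sub>R (\<chi> i. 1)" "y - y' = e *\<^sub>R (\<chi> i. 1)"
  then have "x + y - (x' + y') = (c + e) *\<^sub>R (\<chi> i. 1)"
    by (simp add: scaleR_add_left add_diff_add)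
  then show "\<exists>c. x + y - (x' + y') = c *\<^sub>R (\<chi> i. 1)" by blast
qed

lift_definition minus_tp :: "'a tp \<Rightarrow> 'a tp \<Rightarrow> 'a tp" is "(-)"
  unfolding tp_rel_def
proof (elim exE)
  fix x x' y y' :: "real ^ 'a" and c e
  assume "x - x' = c *\<^sub>R (\<chi> i. 1)" "y - y' = e *\<^sub>R (\<chi> i. 1)"
  moreover have "x - y - (x' - y') = (x - x') - (y - y')" by simp
  ultimately have "x - y - (x' - y') = (c - e) *\<^sub>R (\<chi> i. 1)"
    by (simp only: scaleR_diff_left)
  then show "\<exists>c. x - y - (x' - y') = c *\<^sub>R (\<chi> i. 1)" by blast
qed

lift_definition uminus_tp :: "'a tp \<Rightarrow> 'a tp" is uminus
  unfolding tp_rel_def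
proof (elim exE)
  fix x y :: "real ^ 'a" and c
  assume "x - y = c *\<^sub>R (\<chi> i. 1)"
  moreover have "- x - - y = - (x - y)" by simp
  ultimately have "- x - - y = (- c) *\<^sub>R (\<chi> i. 1)"
    by (simp only: scaleR_minus_left)
  then show "\<exists>c. - x - - y = c *\<^sub>R (\<chi> i. 1)" by blast
qed

lift_definition scaleR_tp :: "real \<Rightarrow> 'a tp \<Rightarrow> 'a tp" is "scaleR"
  unfolding tp_rel_def
proof (elim exE)
  fix r :: real and x y :: "real ^ 'a" and c
  assume "x - y = c *\<^sub>R (\<chi> i. 1)"
  then have "r *\<^sub>R x - r *\<^sub>R y = (r * c) *\<^sub>R (\<chi> i. 1)"
    by (simp only: scaleR_diff_right [symmetric] scaleR_scaleR)
  then show "\<exists>c. r *\<^sub>R x - r *\<^sub>R y = c *\<^sub>R (\<chi> i. 1)" by blast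
qed

instance
proof -
  have refl: "tp_rel x x" for x :: "real ^ 'a"
    by (rule equivp_reflp[OF equivp_tp_rel])
  show "OFCLASS('a tp, real_vector_class)"
    by standard (transfer; simp add: algebra_simps refl)+
qed

end


section \<open>Tropical convex hull and dimension\<close>

definition trop_lincomb :: "('n::finite \<Rightarrow> real) \<Rightarrow> ('n \<Rightarrow> real ^ 'd) \<Rightarrow> real ^ 'd" where
  "trop_lincomb a v = (\<chi> i. Min (range (\<lambda>j. a j + v j $ i)))"

definition trop_hull :: "('n::finite \<Rightarrow> real ^ 'd) \<Rightarrow> 'd tp set" where
  "trop_hull v = range (\<lambda>a. abs_tp (trop_lincomb a v))"

text \<open>The library's \<^const>\<open>polyhedron\<close> and \<^const>\<open>aff_dim\<close> require a Euclidean space, which a quotient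
  space is not (and which must be nonzero, excluding the case of a single coordinate); the
  following are their counterparts for an arbitrary real vector space.\<close>

definition polyhedral_set :: "'a::real_vector set \<Rightarrow> bool" where
  "polyhedral_set P \<longleftrightarrow>
     (\<exists>H. finite H \<and> P = \<Inter>H \<and> (\<forall>h\<in>H. \<exists>(l :: 'a \<Rightarrow> real) b. linear l \<and> h = {x. l x \<le> b}))"

definition affine_dimension :: "'a::real_vector set \<Rightarrow> nat" where
  "affine_dimension P = dim {x - y |x y. x \<in> P \<and> y \<in> P}"

text \<open>Boundedness of \<open>P\<close> need not be required: it is inherited from \<open>S\<close> when \<open>S\<close> is a bounded
  polyhedral complex.\<close>

definition polyhedral_dim :: "'a::real_vector set \<Rightarrow> nat" where
  "polyhedral_dim S = Max {affine_dimension P |P. polyhedral_set P \<and> P \<noteq> {} \<and> P \<subseteq> S}"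

end

theory Submission
  imports Defs "HOL-Combinatorics.Cycles"
begin

text \<open>A point \<open>x\<close> of the hull has a combinatorial type: row \<open>i\<close> is covered by column \<open>j\<close> if, in the
  tropical combination with the least admissible coefficients, column \<open>j\<close> attains the minimum in
  row \<open>i\<close>. Since the least coefficient of column \<open>j\<close> is the maximum of \<open>x\<^sub>i - M\<^sub>i\<^sub>j\<close> over the rows, the type
  is described by inequalities between coordinate differences, and \<open>x\<close> lies in the hull if and
  only if each row is covered (\<open>mem_trop_hull_iff\<close>). Both inequalities between rank and dimension
  come from the fact that the coefficients of such a combination are dual potentials for an
  assignment problem, whose strict feasibility expresses tropical non-singularity.

  A convex set \<open>P\<close> in the hull is covered by finitely many affine spaces, one for each type, because
  two rows covered by the same column have a fixed coordinate difference. Hence one type already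
  rules all of \<open>P\<close> (\<open>convex_subset_of_finite_affine_cover\<close>). Put two rows in one block if their
  coordinate difference is constant on \<open>P\<close>; with \<open>r\<close> blocks, \<open>P\<close> has dimension at most \<open>r - 1\<close>. Pick
  one row of each block and a column covering it at a point with the ruling type. No such column
  covers a chosen row of another block, so the coefficients are strict potentials and the chosen
  \<open>r \<times> r\<close> submatrix is non-singular (\<open>nonsingular_of_convex_subset\<close>).

  Conversely, a non-singular \<open>r \<times> r\<close> submatrix has strict potentials: this is the shortest-path
  form of linear programming duality (\<open>potential_of_not_trop_singular\<close>). Used as coefficients of
  the chosen columns, all other columns being given large coefficients, and moved slightly so that
  in every row of \<open>M\<close> only one column attains the minimum, they give a point near which the \<open>r\<close>
  coefficients can be varied independently without changing the minimizers. This sweeps out a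
  polyhedron of dimension \<open>r - 1\<close> in the quotient
  (\<open>polyhedral_subset_of_nonsingular\<close>).\<close>

section \<open>Potentials from nonnegative permutation sums\<close>

fun walk_cost :: "('a \<Rightarrow> 'a \<Rightarrow> real) \<Rightarrow> 'a list \<Rightarrow> real" where
  "walk_cost w (x # y # xs) = w x y + walk_cost w (y # xs)"
| "walk_cost w xs = 0"

lemma walk_cost_append:
  "walk_cost w (xs @ y # zs) = walk_cost w (xs @ [y]) + walk_cost w (y # zs)"
proof (induction xs)
  case Nil
  then show ?case by simp
next
  case (Cons x xs)
  then show ?case by (cases xs) auto
qed

lemma walk_cost_snoc:
  "walk_cost w (x # xs @ [y]) = sum_list (map2 w (x # xs) (xs @ [y]))"
  by (induction xs arbitrary: x) auto

lemma walk_cost_distinct_cycle: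
  assumes "distinct cs" "cs \<noteq> []"
  shows "walk_cost w (cs @ [hd cs]) = (\<Sum>i\<in>set cs. w i (cycle_of_list cs i))"
proof -
  obtain x xs where cs: "cs = x # xs" using assms(2) by (cases cs) auto
  have rot: "map (cycle_of_list cs) cs = xs @ [x]"
    using cyclic_rotation[OF assms(1), of 1] cs by simp
  have "walk_cost w (cs @ [hd cs]) = sum_list (map2 w cs (map (cycle_of_list cs) cs))"
    unfolding rot using walk_cost_snoc[of w x xs x] by (simp add: cs)
  also have "map2 w cs (map (cycle_of_list cs) cs) = map (\<lambda>i. w i (cycle_of_list cs i)) cs"
    by (simp add: zip_map2 zip_same_conv_map)
  finally show ?thesis using assms(1) by (simp add: sum_list_distinct_conv_sum_set)
qed

text \<open>A closed walk that visits some vertex twice splits there into two shorter closed walks, so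
  the simple cycles decide the sign of all closed walks.\<close>

lemma closed_walk_cost_nonneg:
  assumes cyc: "\<And>cs. \<lbrakk>distinct cs; cs \<noteq> []; set cs \<subseteq> S\<rbrakk> \<Longrightarrow> 0 \<le> walk_cost w (cs @ [hd cs])"
    and "cs \<noteq> []" "set cs \<subseteq> S"
  shows "0 \<le> walk_cost w (cs @ [hd cs])"
  using assms(2,3)
proof (induction "length cs" arbitrary: cs rule: less_induct)
  case less
  show ?case
  proof (cases "distinct cs")
    case True
    then show ?thesis using cyc less.prems by blast
  next
    case False
    then obtain xs ys zs y where cs: "cs = xs @ [y] @ ys @ [y] @ zs"
      using not_distinct_decomp by blast
    have h: "hd (xs @ y # zs) = hd cs" by (cases xs) (auto simp: cs)
    have "walk_cost w (cs @ [hd cs]) = walk_cost w (xs @ y # ys @ y # (zs @ [hd cs]))"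
      by (simp add: cs)
    also have "\<dots> = walk_cost w (xs @ [y]) + walk_cost w ((y # ys) @ y # (zs @ [hd cs]))"
      by (subst walk_cost_append) simp
    also have "walk_cost w ((y # ys) @ y # (zs @ [hd cs]))
        = walk_cost w ((y # ys) @ [y]) + walk_cost w (y # (zs @ [hd cs]))"
      by (rule walk_cost_append)
    also have "walk_cost w (xs @ [y]) + (walk_cost w ((y # ys) @ [y]) + walk_cost w (y # (zs @ [hd cs])))
        = walk_cost w ((y # ys) @ [hd (y # ys)])
          + walk_cost w ((xs @ y # zs) @ [hd (xs @ y # zs)])"
      unfolding h using walk_cost_append[of w xs y "zs @ [hd cs]"] by simp
    also have "\<dots> \<ge> 0"
      by (intro add_nonneg_nonneg less.hyps) (use less.prems cs in auto)
    finally show ?thesis .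
  qed
qed

text \<open>The potential of a vertex is the cost of a cheapest walk from it to a fixed root; without
  negative closed walks this infimum is finite.\<close>

lemma potential_of_nonneg_permutation_sums:
  fixes w :: "'a \<Rightarrow> 'a \<Rightarrow> real"
  assumes fin: "finite S" and diag: "\<And>i. i \<in> S \<Longrightarrow> w i i = 0"
    and perm: "\<And>\<sigma>. \<sigma> permutes S \<Longrightarrow> 0 \<le> (\<Sum>i\<in>S. w i (\<sigma> i))"
  shows "\<exists>u. \<forall>i\<in>S. \<forall>k\<in>S. u i \<le> w i k + u k"
proof (cases "S = {}")
  case False
  then obtain s where s: "s \<in> S" by blast
  have cycle: "0 \<le> walk_cost w (cs @ [hd cs])"
    if "distinct cs" "cs \<noteq> []" "set cs \<subseteq> S" for cs
  proof -
    have "(\<Sum>i\<in>S. w i (cycle_of_list cs i)) = (\<Sum>i\<in>set cs. w i (cycle_of_list cs i))"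
      using that(3) fin diag
      by (intro sum.mono_neutral_right) (auto simp: id_outside_supp)
    moreover have "cycle_of_list cs permutes S"
      using cycle_permutes permutes_subset that(3) by blast
    ultimately show ?thesis
      using perm walk_cost_distinct_cycle[OF that(1,2), of w] by metis
  qed
  define C where "C i = {walk_cost w (i # xs @ [s]) |xs. set xs \<subseteq> S}" for i
  define u where "u i = Inf (C i)" for i
  have bdd: "bdd_below (C i)" if i: "i \<in> S" for i
  proof (rule bdd_belowI)
    fix c assume "c \<in> C i"
    then obtain xs where c: "c = walk_cost w (i # xs @ [s])" and xs: "set xs \<subseteq> S"
      unfolding C_def by blast
    have "0 \<le> walk_cost w ((i # xs @ [s]) @ [hd (i # xs @ [s])])"
      by (rule closed_walk_cost_nonneg[where S = S]) (use cycle xs i s in auto)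
    also have "\<dots> = c + w s i"
      using walk_cost_append[of w "i # xs" s "[i]"] by (simp add: c)
    finally show "- w s i \<le> c" by simp
  qed
  have "u i \<le> w i k + u k" if "i \<in> S" "k \<in> S" for i k
  proof -
    have "u i - w i k \<le> u k"
      unfolding u_def[of k]
    proof (rule cInf_greatest)
      show "C k \<noteq> {}" unfolding C_def by (auto intro: exI[of _ "[]"])
    next
      fix c assume "c \<in> C k"
      then obtain xs where c: "c = walk_cost w (k # xs @ [s])" and xs: "set xs \<subseteq> S"
        unfolding C_def by blast
      have "walk_cost w (i # (k # xs) @ [s]) \<in> C i"
        unfolding C_def using xs that(2) by (intro CollectI exI[of _ "k # xs"]) auto
      then have "u i \<le> walk_cost w (i # (k # xs) @ [s])"
        unfolding u_def using bdd[OF that(1)] by (intro cInf_lower)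
      then show "u i - w i k \<le> c" by (simp add: c)
    qed
    then show ?thesis by simp
  qed
  then show ?thesis by blast
qed simp


section \<open>Tropical non-singularity through potentials\<close>

lemma finite_positive_lower_bound:
  fixes g :: "'a \<Rightarrow> real"
  assumes "finite S" "\<And>x. x \<in> S \<Longrightarrow> 0 < g x"
  shows "\<exists>e>0. \<forall>x\<in>S. e \<le> g x"
  using assms
proof (induction S rule: finite_induct)
  case empty
  then show ?case by (auto intro: exI[of _ 1])
next
  case (insert x S)
  then obtain e where "e > 0" "\<forall>y\<in>S. e \<le> g y" by auto
  then show ?case using insert.prems[of x]
    by (intro exI[of _ "min e (g x)"]) (auto simp: min.coboundedI1)
qed

lemma not_trop_singular_iff:
  "\<not> trop_singular r A \<longleftrightarrow>
     (\<exists>\<sigma>. \<sigma> permutes {..<r} \<and>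
        (\<forall>\<tau>. \<tau> permutes {..<r} \<and> \<tau> \<noteq> \<sigma> \<longrightarrow> (\<Sum>i<r. A i (\<sigma> i)) < (\<Sum>i<r. A i (\<tau> i))))"
proof -
  define W where "W \<sigma> = (\<Sum>i<r. A i (\<sigma> i))" for \<sigma>
  define S where "S = {\<sigma>. \<sigma> permutes {..<r}}"
  have fin: "finite (W ` S)" and ne: "W ` S \<noteq> {}"
    unfolding S_def using finite_permutations[of "{..<r}"] permutes_id[of "{..<r}"] by blast+
  have sing: "trop_singular r A \<longleftrightarrow>
      (\<exists>\<sigma> \<tau>. \<sigma> \<in> S \<and> \<tau> \<in> S \<and> \<sigma> \<noteq> \<tau> \<and> W \<sigma> = Min (W ` S) \<and> W \<tau> = Min (W ` S))"
    unfolding trop_singular_def Let_def W_def S_def by auto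
  obtain \<sigma> where \<sigma>: "\<sigma> \<in> S" "W \<sigma> = Min (W ` S)" using Min_in[OF fin ne] by force
  have le: "W \<sigma> \<le> W \<tau>" if "\<tau> \<in> S" for \<tau> using that fin \<sigma> by simp
  have "\<not> trop_singular r A \<longleftrightarrow> (\<exists>\<sigma>. \<sigma> \<in> S \<and> (\<forall>\<tau>. \<tau> \<in> S \<and> \<tau> \<noteq> \<sigma> \<longrightarrow> W \<sigma> < W \<tau>))"
  proof
    assume "\<not> trop_singular r A"
    then have "\<forall>\<tau>. \<tau> \<in> S \<and> \<tau> \<noteq> \<sigma> \<longrightarrow> W \<sigma> < W \<tau>"
      using \<sigma> le unfolding sing by (metis order_le_less)
    with \<sigma> show "\<exists>\<sigma>. \<sigma> \<in> S \<and> (\<forall>\<tau>. \<tau> \<in> S \<and> \<tau> \<noteq> \<sigma> \<longrightarrow> W \<sigma> < W \<tau>)" by blast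
  next
    assume "\<exists>\<sigma>. \<sigma> \<in> S \<and> (\<forall>\<tau>. \<tau> \<in> S \<and> \<tau> \<noteq> \<sigma> \<longrightarrow> W \<sigma> < W \<tau>)"
    then obtain \<pi> where \<pi>: "\<pi> \<in> S" "\<And>\<tau>. \<tau> \<in> S \<Longrightarrow> \<tau> \<noteq> \<pi> \<Longrightarrow> W \<pi> < W \<tau>" by blast
    then have "\<tau> = \<pi>" if "\<tau> \<in> S" "W \<tau> = Min (W ` S)" for \<tau>
      using that \<sigma> le by (metis not_less)
    then show "\<not> trop_singular r A" unfolding sing by metis
  qed
  then show ?thesis unfolding S_def W_def by simp
qed

text \<open>Column potentials change the weights of all permutations by the same amount, and after the
  change the diagonal wins row by row.\<close>

lemma not_trop_singular_of_potential:
  assumes "\<And>i k. \<lbrakk>i < r; k < r; i \<noteq> k\<rbrakk> \<Longrightarrow> c i + A i i < c k + A i k"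
  shows "\<not> trop_singular r A"
  unfolding not_trop_singular_iff
proof (intro exI[of _ id] conjI allI impI)
  show "id permutes {..<r}" by (rule permutes_id)
  fix \<tau> assume \<tau>: "\<tau> permutes {..<r} \<and> \<tau> \<noteq> id"
  then obtain j where j: "j < r" "\<tau> j \<noteq> j"
    by (metis eq_id_iff lessThan_iff permutes_not_in)
  have in_r: "\<tau> i < r" if "i < r" for i using \<tau> that permutes_in_image by fastforce
  have "(\<Sum>i<r. c i + A i i) < (\<Sum>i<r. c (\<tau> i) + A i (\<tau> i))"
  proof (rule sum_strict_mono_ex1)
    show "\<forall>i\<in>{..<r}. c i + A i i \<le> c (\<tau> i) + A i (\<tau> i)"
    proof
      fix i assume "i \<in> {..<r}"
      then show "c i + A i i \<le> c (\<tau> i) + A i (\<tau> i)"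
        using assms[of i "\<tau> i"] in_r[of i] by (cases "\<tau> i = i") auto
    qed
    show "\<exists>i\<in>{..<r}. c i + A i i < c (\<tau> i) + A i (\<tau> i)"
      using assms[of j "\<tau> j"] in_r[of j] j by auto
  qed simp
  moreover have "(\<Sum>i<r. c (\<tau> i)) = (\<Sum>i<r. c i)"
    using \<tau> sum.permute[of \<tau> "{..<r}" c] by (simp add: o_def)
  ultimately show "(\<Sum>i<r. A i (id i)) < (\<Sum>i<r. A i (\<tau> i))"
    by (simp add: sum.distrib)
qed

text \<open>Only finitely many permutations compete with the minimizer, so a small amount can be subtracted
  from each entry off its diagonal and the minimizer still wins. Potentials for the reduced
  matrix satisfy strict inequalities for the original one.\<close>

lemma potential_of_not_trop_singular:
  assumes "\<not> trop_singular r A"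
  obtains \<sigma> c where "\<sigma> permutes {..<r}"
    "\<And>i k. \<lbrakk>i < r; k < r; i \<noteq> k\<rbrakk> \<Longrightarrow> c i + A i (\<sigma> i) < c k + A i (\<sigma> k)"
proof -
  obtain \<sigma> where \<sigma>: "\<sigma> permutes {..<r}"
    and less: "\<And>\<tau>. \<tau> permutes {..<r} \<Longrightarrow> \<tau> \<noteq> \<sigma> \<Longrightarrow> (\<Sum>i<r. A i (\<sigma> i)) < (\<Sum>i<r. A i (\<tau> i))"
    using assms unfolding not_trop_singular_iff by blast
  define B where "B i k = A i (\<sigma> k) - A i (\<sigma> i)" for i k
  define T where "T = {\<tau>. \<tau> permutes {..<r} \<and> \<tau> \<noteq> id}"
  have "finite T" unfolding T_def by (rule finite_subset[OF _ finite_permutations[of "{..<r}"]]) auto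
  moreover have pos: "0 < (\<Sum>i<r. B i (\<tau> i))" if "\<tau> \<in> T" for \<tau>
  proof -
    have "\<sigma> \<circ> \<tau> \<noteq> \<sigma>"
    proof
      assume eq: "\<sigma> \<circ> \<tau> = \<sigma>"
      have "\<tau> x = x" for x
        using fun_cong[OF eq, of x] permutes_inj[OF \<sigma>] by (simp add: inj_eq)
      then show False using that unfolding T_def by auto
    qed
    moreover have "\<sigma> \<circ> \<tau> permutes {..<r}"
      using \<sigma> that unfolding T_def by (auto intro: permutes_compose)
    ultimately have "(\<Sum>i<r. A i (\<sigma> i)) < (\<Sum>i<r. A i ((\<sigma> \<circ> \<tau>) i))" using less by blast
    then show ?thesis by (simp add: B_def sum_subtractf)
  qed
  ultimately obtain e where e: "e > 0" "\<forall>\<tau>\<in>T. e \<le> (\<Sum>i<r. B i (\<tau> i))"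
    using finite_positive_lower_bound[of T "\<lambda>\<tau>. \<Sum>i<r. B i (\<tau> i)"] by blast
  \<comment> \<open>A permutation picks up the reduction at most \<open>r\<close> times; the successor keeps the quotient
    positive for \<open>r = 0\<close>.\<close>
  define w where "w i k = (if i = k then 0 else B i k - e / real (Suc r))" for i k
  have "0 \<le> (\<Sum>i<r. w i (\<tau> i))" if \<tau>: "\<tau> permutes {..<r}" for \<tau>
  proof (cases "\<tau> = id")
    case True
    then show ?thesis by (simp add: w_def)
  next
    case False
    then have "e \<le> (\<Sum>i<r. B i (\<tau> i))" using \<tau> e(2) unfolding T_def by blast
    moreover have "real r * (e / real (Suc r)) \<le> e" using e(1) by (simp add: field_simps)
    ultimately have "0 \<le> (\<Sum>i<r. B i (\<tau> i) - e / real (Suc r))"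
      by (simp add: sum_subtractf)
    also have "\<dots> \<le> (\<Sum>i<r. w i (\<tau> i))"
      using e(1) by (intro sum_mono) (auto simp: w_def B_def)
    finally show ?thesis .
  qed
  then obtain u where u: "\<forall>i\<in>{..<r}. \<forall>k\<in>{..<r}. u i \<le> w i k + u k"
    using potential_of_nonneg_permutation_sums[of "{..<r}" w] by (auto simp: w_def)
  show ?thesis
  proof (rule that[of \<sigma> u])
    fix i k assume "i < r" "k < r" "i \<noteq> k"
    then have "u i \<le> B i k - e / real (Suc r) + u k" using u by (force simp: w_def)
    moreover have "0 < e / real (Suc r)" using e(1) by simp
    ultimately show "u i + A i (\<sigma> i) < u k + A i (\<sigma> k)" unfolding B_def by linarith
  qed (rule \<sigma>)
qed


section \<open>Coordinate differences on tropical projective space\<close>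

lift_definition coord_diff :: "'d::finite \<Rightarrow> 'd \<Rightarrow> 'd tp \<Rightarrow> real" is
  "\<lambda>i i' x. x $ i - x $ i'"
  by (auto simp: tp_rel_def vec_eq_iff algebra_simps)

lemma coord_diff_abs_tp [simp]: "coord_diff i i' (abs_tp x) = x $ i - x $ i'"
  by transfer simp

lemma linear_coord_diff: "linear (coord_diff i i')"
  by (rule linearI; transfer; simp add: algebra_simps)

lemmas coord_diff_simps =
  linear_add[OF linear_coord_diff] linear_diff[OF linear_coord_diff]
  linear_cmul[OF linear_coord_diff] linear_sum[OF linear_coord_diff]
  linear_0[OF linear_coord_diff]

lemma coord_diff_trans: "coord_diff i j X + coord_diff j k X = coord_diff i k X"
  by transfer simp

lemma coord_diff_self [simp]: "coord_diff i i X = 0"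
  by transfer simp

lemma tp_eq_iff:
  fixes X Y :: "'d::finite tp"
  shows "X = Y \<longleftrightarrow> (\<forall>i i'. coord_diff i i' X = coord_diff i i' Y)"
proof
  assume "\<forall>i i'. coord_diff i i' X = coord_diff i i' Y"
  then show "X = Y"
  proof transfer
    fix x y :: "real ^ 'd" assume *: "\<forall>i i'. x $ i - x $ i' = y $ i - y $ i'"
    obtain i0 :: 'd where True by blast
    have "x $ i - y $ i = x $ i0 - y $ i0" for i using *[rule_format, of i i0] by simp
    then have "x - y = (x $ i0 - y $ i0) *\<^sub>R (\<chi> i. 1)" by (simp add: vec_eq_iff)
    then show "tp_rel x y" unfolding tp_rel_def by blast
  qed
qed simp

text \<open>The directions along which points can move while coordinate differences within each fibre of
  \<open>\<rho>\<close> stay fixed.\<close>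

definition block_space :: "('d::finite \<Rightarrow> 'b) \<Rightarrow> 'd tp set" where
  "block_space \<rho> = {X. \<forall>i i'. \<rho> i = \<rho> i' \<longrightarrow> coord_diff i i' X = 0}"

definition block_vector :: "('d::finite \<Rightarrow> 'b) \<Rightarrow> 'b \<Rightarrow> 'd tp" where
  "block_vector \<rho> k = abs_tp (\<chi> i. of_bool (\<rho> i = k))"

lemma coord_diff_block_vector:
  "coord_diff i i' (block_vector \<rho> k) = of_bool (\<rho> i = k) - of_bool (\<rho> i' = k)"
  by (simp add: block_vector_def)

lemma subspace_block_space: "subspace (block_space \<rho>)"
  unfolding subspace_def block_space_def by (auto simp: coord_diff_simps)

text \<open>The indicator vectors of the blocks add up to the zero of the quotient, and up to scaling
  this is their only linear relation; leaving one of them out gives a basis.\<close>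

lemma block_space_basis:
  fixes \<rho> :: "'d::finite \<Rightarrow> 'b"
  obtains B where "finite B" "independent B" "span B = block_space \<rho>"
    "card B + 1 = card (range \<rho>)" "B \<subseteq> range (block_vector \<rho>)"
proof -
  obtain i0 :: 'd where True by blast
  define K where "K = range \<rho> - {\<rho> i0}"
  define B where "B = block_vector \<rho> ` K"
  have finK: "finite K" unfolding K_def by simp
  have cd: "coord_diff i i' (\<Sum>k\<in>K. g k *\<^sub>R block_vector \<rho> k)
      = (if \<rho> i \<in> K then g (\<rho> i) else 0) - (if \<rho> i' \<in> K then g (\<rho> i') else 0)" for g i i'
  proof -
    have pick: "(\<Sum>k\<in>K. g k * of_bool (\<rho> i = k)) = (if \<rho> i \<in> K then g (\<rho> i) else 0)" for i
    proof -
      have "(\<Sum>k\<in>K. g k * of_bool (\<rho> i = k)) = (\<Sum>k\<in>K. if \<rho> i = k then g k else 0)"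
        by (rule sum.cong) auto
      also have "\<dots> = (if \<rho> i \<in> K then g (\<rho> i) else 0)" by (rule sum.delta'[OF finK])
      finally show ?thesis .
    qed
    have "coord_diff i i' (\<Sum>k\<in>K. g k *\<^sub>R block_vector \<rho> k)
        = (\<Sum>k\<in>K. g k * of_bool (\<rho> i = k)) - (\<Sum>k\<in>K. g k * of_bool (\<rho> i' = k))"
      by (simp add: coord_diff_simps coord_diff_block_vector right_diff_distrib sum_subtractf)
    then show ?thesis unfolding pick .
  qed
  have inj: "inj_on (block_vector \<rho>) K"
  proof (rule inj_onI)
    fix k l assume kl: "k \<in> K" "l \<in> K" "block_vector \<rho> k = block_vector \<rho> l"
    from kl(1) obtain i where i: "\<rho> i = k" "k \<noteq> \<rho> i0" unfolding K_def by blast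
    have "coord_diff i i0 (block_vector \<rho> k) = coord_diff i i0 (block_vector \<rho> l)"
      using kl(3) by simp
    then show "k = l" using i kl(2) unfolding coord_diff_block_vector K_def
      by (auto split: if_splits simp: of_bool_def)
  qed
  have indep: "independent B"
  proof (rule real_vector.independent_if_scalars_zero)
    show "finite B" unfolding B_def using finK by simp
  next
    fix g b assume "(\<Sum>x\<in>B. g x *\<^sub>R x) = 0" and b: "b \<in> B"
    then have 0: "(\<Sum>k\<in>K. g (block_vector \<rho> k) *\<^sub>R block_vector \<rho> k) = 0"
      unfolding B_def by (simp add: sum.reindex[OF inj])
    from b obtain i where i: "\<rho> i \<in> K" "b = block_vector \<rho> (\<rho> i)"
      unfolding B_def K_def by blast
    have "coord_diff i i0 (\<Sum>k\<in>K. g (block_vector \<rho> k) *\<^sub>R block_vector \<rho> k) = 0"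
      unfolding 0 by (simp add: coord_diff_simps)
    then show "g b = 0" using i unfolding cd by (simp add: K_def)
  qed
  have "block_vector \<rho> k \<in> block_space \<rho>" for k
    by (simp add: block_space_def coord_diff_block_vector)
  then have "span B \<subseteq> block_space \<rho>"
    unfolding B_def by (intro span_minimal subspace_block_space) auto
  moreover have "block_space \<rho> \<subseteq> span B"
  proof
    fix X assume X: "X \<in> block_space \<rho>"
    define g where "g k = coord_diff (inv \<rho> k) i0 X" for k
    have g: "g (\<rho> i) = coord_diff i i0 X" for i
    proof -
      have "\<rho> (inv \<rho> (\<rho> i)) = \<rho> i" by (simp add: f_inv_into_f)
      then have "coord_diff (inv \<rho> (\<rho> i)) i X = 0" using X unfolding block_space_def by blast
      then show ?thesis using coord_diff_trans[of "inv \<rho> (\<rho> i)" i X i0] by (simp add: g_def)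
    qed
    have g0: "coord_diff i i0 X = 0" if "\<rho> i \<notin> K" for i
      using X that unfolding block_space_def K_def by blast
    have "X = (\<Sum>k\<in>K. g k *\<^sub>R block_vector \<rho> k)"
      unfolding tp_eq_iff
    proof (intro allI)
      fix i i'
      have val: "(if \<rho> j \<in> K then g (\<rho> j) else 0) = coord_diff j i0 X" for j
        using g g0 by auto
      show "coord_diff i i' X = coord_diff i i' (\<Sum>k\<in>K. g k *\<^sub>R block_vector \<rho> k)"
        unfolding cd val using coord_diff_trans[of i i' X i0] by simp
    qed
    then show "X \<in> span B"
      unfolding B_def by (metis (no_types, lifting) imageI span_base span_scale span_sum)
  qed
  ultimately have "span B = block_space \<rho>" by blast
  moreover have "card B + 1 = card (range \<rho>)"
    unfolding B_def card_image[OF inj] unfolding K_def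
    using card.remove[of "range \<rho>" "\<rho> i0"] by simp
  ultimately show ?thesis
    using that[of B] finK indep unfolding B_def by blast
qed


section \<open>Covering of rows\<close>

text \<open>For \<open>X\<close> represented by \<open>x\<close>, row \<open>i\<close> is covered by column \<open>j\<close> if it maximizes \<open>x\<^sub>i - M\<^sub>i\<^sub>j\<close>; the
  coordinate differences make this independent of the representative.\<close>

definition covers :: "real ^ 'n ^ 'd \<Rightarrow> 'd tp \<Rightarrow> 'n \<Rightarrow> 'd::finite set" where
  "covers M X j = {i. \<forall>i'. coord_diff i' i X \<le> M $ i' $ j - M $ i $ j}"

text \<open>Any coefficient of column \<open>j\<close> is at least the maximum of \<open>x\<^sub>i - M\<^sub>i\<^sub>j\<close>, so if some combination yields
  \<open>x\<close>, then the one with these least coefficients does, with the minimum in a row attained exactly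
  at the columns that cover it.\<close>

lemma mem_trop_hull_iff:
  fixes M :: "real ^ 'n ^ 'd"
  shows "X \<in> trop_hull (\<lambda>j. column j M) \<longleftrightarrow> (\<forall>i. \<exists>j. i \<in> covers M X j)"
proof
  assume "X \<in> trop_hull (\<lambda>j. column j M)"
  then obtain a where X: "X = abs_tp (trop_lincomb a (\<lambda>j. column j M))"
    unfolding trop_hull_def by blast
  define x where "x = trop_lincomb a (\<lambda>j. column j M)"
  have x: "x $ i = Min (range (\<lambda>j. a j + M $ i $ j))" for i
    by (simp add: x_def trop_lincomb_def column_def)
  have le: "x $ i \<le> a j + M $ i $ j" for i j unfolding x by (rule Min_le) auto
  show "\<forall>i. \<exists>j. i \<in> covers M X j"
  proof
    fix i
    have "x $ i \<in> range (\<lambda>j. a j + M $ i $ j)" unfolding x by (rule Min_in) auto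
    then obtain j where j: "x $ i = a j + M $ i $ j" by blast
    have "x $ i' - x $ i \<le> M $ i' $ j - M $ i $ j" for i' using le[of i' j] j by linarith
    then have "i \<in> covers M X j" by (simp add: covers_def X x_def[symmetric])
    then show "\<exists>j. i \<in> covers M X j" ..
  qed
next
  assume cov: "\<forall>i. \<exists>j. i \<in> covers M X j"
  obtain x where X: "X = abs_tp x" by (metis Quotient3_abs_rep Quotient3_tp)
  define a where "a j = Max (range (\<lambda>i. x $ i - M $ i $ j))" for j
  have ge: "x $ i \<le> a j + M $ i $ j" for i j
  proof -
    have "x $ i - M $ i $ j \<le> a j" unfolding a_def by (rule Max_ge) auto
    then show ?thesis by simp
  qed
  have "x $ i = Min (range (\<lambda>j. a j + M $ i $ j))" for i
  proof (rule sym, rule Min_eqI)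
    from cov obtain j where "i \<in> covers M X j" by blast
    then have *: "x $ i' - M $ i' $ j \<le> x $ i - M $ i $ j" for i'
      unfolding covers_def X by (simp add: algebra_simps)
    have "a j = x $ i - M $ i $ j" unfolding a_def by (rule Max_eqI) (use * in auto)
    then show "x $ i \<in> range (\<lambda>j. a j + M $ i $ j)" by (intro range_eqI[of _ _ j]) simp
  qed (use ge in auto)
  then have "x = trop_lincomb a (\<lambda>j. column j M)"
    by (simp add: vec_eq_iff trop_lincomb_def column_def)
  then show "X \<in> trop_hull (\<lambda>j. column j M)" unfolding trop_hull_def X by blast
qed


section \<open>Polytopes in the hull from non-singular submatrices\<close>

text \<open>Tilting the potentials by distinct multiples of a small number breaks all ties between
  columns in every row and keeps the strict inequalities in the rows \<open>f i\<close>.\<close>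

lemma tie_breaking_potential:
  fixes N :: "'d::finite \<Rightarrow> nat \<Rightarrow> real"
  assumes "\<And>i k. \<lbrakk>i < r; k < r; i \<noteq> k\<rbrakk> \<Longrightarrow> c i + N (f i) i < c k + N (f i) k"
  obtains b where "\<And>i k. \<lbrakk>i < r; k < r; i \<noteq> k\<rbrakk> \<Longrightarrow> b i + N (f i) i < b k + N (f i) k"
    "\<And>i k l. \<lbrakk>k < r; l < r; k \<noteq> l\<rbrakk> \<Longrightarrow> b k + N i k \<noteq> b l + N i l"
proof -
  have lim: "((\<lambda>e. (c k + e * real k + N i k) - (c l + e * real l + N i l))
      \<longlongrightarrow> (c k + N i k) - (c l + N i l)) (at_right 0)" for i k l
    by (auto intro!: tendsto_eq_intros)
  have ev1: "eventually (\<lambda>e. k \<noteq> i \<longrightarrow>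
      0 < (c k + e * real k + N (f i) k) - (c i + e * real i + N (f i) i)) (at_right 0)"
    if "i < r" "k < r" for i k
  proof (cases "k = i")
    case False
    then show ?thesis using order_tendstoD(1)[OF lim, of 0 k "f i" i] assms[of i k] that by simp
  qed simp
  have ev2: "eventually (\<lambda>e. k \<noteq> l \<longrightarrow>
      (c k + e * real k + N i k) - (c l + e * real l + N i l) \<noteq> 0) (at_right 0)" for i k l
  proof (cases "(c k + N i k) - (c l + N i l) = 0")
    case True
    have "eventually (\<lambda>e::real. 0 < e) (at_right 0)" by (simp add: eventually_at_right_less)
    then show ?thesis
    proof eventually_elim
      case (elim e)
      have "(c k + e * real k + N i k) - (c l + e * real l + N i l) = e * (real k - real l)"
        using True by (simp add: algebra_simps)
      then show ?case using elim by simp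
    qed
  next
    case False
    have "eventually (\<lambda>e. (c k + e * real k + N i k) - (c l + e * real l + N i l) \<noteq> 0)
        (at_right 0)"
      using tendsto_imp_eventually_ne[OF lim False] .
    then show ?thesis by (rule eventually_mono) simp
  qed
  have "eventually (\<lambda>e.
      (\<forall>i\<in>{..<r}. \<forall>k\<in>{..<r}. k \<noteq> i \<longrightarrow>
        0 < (c k + e * real k + N (f i) k) - (c i + e * real i + N (f i) i)) \<and>
      (\<forall>i\<in>UNIV. \<forall>k\<in>{..<r}. \<forall>l\<in>{..<r}. k \<noteq> l \<longrightarrow>
        (c k + e * real k + N i k) - (c l + e * real l + N i l) \<noteq> 0)) (at_right 0)"
    by (intro eventually_conj eventually_ball_finite ballI ev1 ev2) auto
  from eventually_happens'[OF trivial_limit_at_right_real this] obtain e where e: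
    "\<forall>i\<in>{..<r}. \<forall>k\<in>{..<r}. k \<noteq> i \<longrightarrow>
        0 < (c k + e * real k + N (f i) k) - (c i + e * real i + N (f i) i)"
    "\<forall>i\<in>UNIV. \<forall>k\<in>{..<r}. \<forall>l\<in>{..<r}. k \<noteq> l \<longrightarrow>
        (c k + e * real k + N i k) - (c l + e * real l + N i l) \<noteq> 0" by blast
  show ?thesis
  proof (rule that[of "\<lambda>k. c k + e * real k"])
    show "c i + e * real i + N (f i) i < c k + e * real k + N (f i) k"
      if "i < r" "k < r" "i \<noteq> k" for i k using e(1) that by force
    show "c k + e * real k + N i k \<noteq> c l + e * real l + N i l"
      if "k < r" "l < r" "k \<noteq> l" for i k l using e(2) that by force
  qed
qed

text \<open>Once every row has a single minimizing column, with a gap to all others, the rows fall into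
  blocks by their minimizers, and near the resulting point the hull contains all points that are
  obtained by shifting the blocks independently.\<close>

lemma polyhedral_subset_of_nonsingular:
  fixes M :: "real ^ 'n ^ 'd" and f :: "nat \<Rightarrow> 'd" and g :: "nat \<Rightarrow> 'n"
  assumes ns: "\<not> trop_singular r (\<lambda>i k. M $ f i $ g k)" and r: "0 < r"
  obtains P where "polyhedral_set P" "P \<noteq> {}" "P \<subseteq> trop_hull (\<lambda>j. column j M)"
    "affine_dimension P + 1 = r"
proof -
  obtain \<sigma> c where
    strict_c: "\<And>i k. \<lbrakk>i < r; k < r; i \<noteq> k\<rbrakk> \<Longrightarrow> c i + M $ f i $ g (\<sigma> i) < c k + M $ f i $ g (\<sigma> k)"
    by (rule potential_of_not_trop_singular[OF ns]) (rule that)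
  define N where "N i k = M $ i $ g (\<sigma> k)" for i k
  obtain b where strict: "\<And>i k. \<lbrakk>i < r; k < r; i \<noteq> k\<rbrakk> \<Longrightarrow> b i + N (f i) i < b k + N (f i) k"
    and ties: "\<And>i k l. \<lbrakk>k < r; l < r; k \<noteq> l\<rbrakk> \<Longrightarrow> b k + N i k \<noteq> b l + N i l"
    by (rule tie_breaking_potential[of r c N f]) (use strict_c in \<open>auto simp: N_def\<close>)
  have "\<exists>k<r. \<forall>l<r. l \<noteq> k \<longrightarrow> b k + N i k < b l + N i l" for i
  proof -
    have "finite {..<r}" "{..<r} \<noteq> {}" using r by auto
    then obtain k where k: "is_arg_min (\<lambda>k. b k + N i k) (\<lambda>k. k \<in> {..<r}) k"
      using ex_is_arg_min_if_finite by blast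
    then have k': "k < r" "\<And>l. l < r \<Longrightarrow> b k + N i k \<le> b l + N i l"
      by (auto simp: is_arg_min_linorder)
    have "b k + N i k < b l + N i l" if "l < r" "l \<noteq> k" for l
      using k'(2)[OF that(1)] ties[OF k'(1) that(1), of i] that(2) by linarith
    then show ?thesis using k'(1) by blast
  qed
  then obtain \<rho> where \<rho>: "\<And>i. \<rho> i < r"
    "\<And>i l. \<lbrakk>l < r; l \<noteq> \<rho> i\<rbrakk> \<Longrightarrow> b (\<rho> i) + N i (\<rho> i) < b l + N i l" by metis
  have \<rho>f: "\<rho> (f k) = k" if "k < r" for k
    using strict[OF that \<rho>(1)[of "f k"]] \<rho>(2)[OF that, of "f k"] by fastforce
  have range: "range \<rho> = {..<r}"
    using \<rho>(1) \<rho>f by (metis imageI UNIV_I lessThan_iff subsetI subset_antisym image_subsetI)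
  define y where "y i = b (\<rho> i) + N i (\<rho> i)" for i
  \<comment> \<open>The number \<open>\<delta>\<close> bounds from below the gap in each row between the minimum and the other
    entries \<open>b k + N i k\<close>; blocks shifted against each other by at most \<open>\<delta>\<close> keep their minimizers.\<close>
  define S where "S = (UNIV \<times> {..<r}) \<inter> {(i, k). k \<noteq> \<rho> i}"
  obtain \<delta> where \<delta>: "\<delta> > 0" "\<forall>p\<in>S. \<delta> \<le> b (snd p) + N (fst p) (snd p) - y (fst p)"
    using finite_positive_lower_bound[of S "\<lambda>p. b (snd p) + N (fst p) (snd p) - y (fst p)"]
      \<rho>(2) unfolding S_def y_def by fastforce
  have gap: "y i + (if \<rho> i = k then 0 else \<delta>) \<le> b k + N i k" if "k < r" for i k
    using \<delta>(2)[rule_format, of "(i, k)"] that unfolding S_def y_def by auto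
  define H where "H i i' = {X. coord_diff i i' X \<le> y i - y i' + (if \<rho> i = \<rho> i' then 0 else \<delta>)}" for i i'
  define P where "P = (\<Inter>(i, i')\<in>UNIV. H i i')"
  have mem_P: "X \<in> P \<longleftrightarrow>
      (\<forall>i i'. coord_diff i i' X \<le> y i - y i' + (if \<rho> i = \<rho> i' then 0 else \<delta>))" for X
    unfolding P_def H_def by auto
  have poly: "polyhedral_set P"
    unfolding polyhedral_set_def
  proof (intro exI[of _ "range (\<lambda>(i, i'). H i i')"] conjI ballI)
    show "P = \<Inter> (range (\<lambda>(i, i'). H i i'))" unfolding P_def ..
    fix h assume "h \<in> range (\<lambda>(i, i'). H i i')"
    then obtain i i' where "h = H i i'" by auto
    then show "\<exists>(l :: 'd tp \<Rightarrow> real) b. linear l \<and> h = {X. l X \<le> b}"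
      unfolding H_def
      by (intro exI[of _ "coord_diff i i'"]
          exI[of _ "y i - y i' + (if \<rho> i = \<rho> i' then 0 else \<delta>)"] conjI linear_coord_diff)
  qed simp
  define Y where "Y = abs_tp (\<chi> i. y i)"
  have shift: "Y + t *\<^sub>R block_vector \<rho> k \<in> P" if "0 \<le> t" "t \<le> \<delta>" for t k
    unfolding mem_P Y_def using that
    by (auto simp: coord_diff_simps coord_diff_block_vector)
  have YP: "Y \<in> P" using shift[of 0] \<delta>(1) by simp
  have hull: "P \<subseteq> trop_hull (\<lambda>j. column j M)"
  proof
    fix X assume X: "X \<in> P"
    have "i \<in> covers M X (g (\<sigma> (\<rho> i)))" for i
      unfolding covers_def
    proof (intro CollectI allI)
      fix i'
      have "coord_diff i' i X \<le> y i' - y i + (if \<rho> i' = \<rho> i then 0 else \<delta>)"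
        using X unfolding mem_P by blast
      also have "\<dots> \<le> N i' (\<rho> i) - N i (\<rho> i)"
        using gap[OF \<rho>(1)[of i], of i'] by (simp add: y_def)
      finally show "coord_diff i' i X \<le> M $ i' $ g (\<sigma> (\<rho> i)) - M $ i $ g (\<sigma> (\<rho> i))"
        by (simp add: N_def)
    qed
    then show "X \<in> trop_hull (\<lambda>j. column j M)" unfolding mem_trop_hull_iff by blast
  qed
  define D where "D = {X - Z |X Z. X \<in> P \<and> Z \<in> P}"
  obtain B where B: "independent B" "span B = block_space \<rho>"
    "card B + 1 = card (range \<rho>)" "B \<subseteq> range (block_vector \<rho>)"
    by (rule block_space_basis[of \<rho>])
  have "D \<subseteq> block_space \<rho>"
  proof -
    have rigid: "coord_diff i i' X = y i - y i'" if "X \<in> P" "\<rho> i = \<rho> i'" for X i i'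
    proof -
      have "coord_diff i i' X \<le> y i - y i'" "coord_diff i' i X \<le> y i' - y i"
        using that(1)[unfolded mem_P, rule_format, of i i']
          that(1)[unfolded mem_P, rule_format, of i' i] that(2) by auto
      then show ?thesis using coord_diff_trans[of i i' X i] coord_diff_self[of i X] by linarith
    qed
    then show ?thesis unfolding D_def block_space_def by (auto simp: coord_diff_simps)
  qed
  then have "span D \<subseteq> span B" unfolding B(2) by (rule span_minimal) (rule subspace_block_space)
  moreover have "block_vector \<rho> k \<in> span D" for k
  proof -
    have "\<delta> *\<^sub>R block_vector \<rho> k = (Y + \<delta> *\<^sub>R block_vector \<rho> k) - Y" by simp
    moreover have "Y + \<delta> *\<^sub>R block_vector \<rho> k \<in> P" using \<delta>(1) by (intro shift) auto
    ultimately have "\<delta> *\<^sub>R block_vector \<rho> k \<in> D" unfolding D_def using YP by blast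
    then have "(1 / \<delta>) *\<^sub>R (\<delta> *\<^sub>R block_vector \<rho> k) \<in> span D" by (intro span_scale span_base)
    then show ?thesis using \<delta>(1) by simp
  qed
  then have "span B \<subseteq> span D" using B(4) by (intro span_minimal) auto
  ultimately have "dim D = card B" using B(1) by (intro real_vector.dim_eq_card) auto
  then have "affine_dimension P + 1 = r"
    using B(3) unfolding affine_dimension_def D_def[symmetric] range by simp
  then show ?thesis using that poly YP hull by blast
qed


section \<open>Non-singular submatrices from polyhedra in the hull\<close>

text \<open>By induction, the segment between a point outside one member and a point outside all the
  others would have its infinitely many interior points in those others, although each of them,
  being affine and missing an endpoint, contains at most one point of the segment's line.\<close>

lemma convex_subset_of_finite_affine_cover:
  fixes P :: "'a::real_vector set"
  assumes "finite \<F>" "\<And>A. A \<in> \<F> \<Longrightarrow> affine A" "convex P" "P \<noteq> {}" "P \<subseteq> \<Union>\<F>"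
  shows "\<exists>A\<in>\<F>. P \<subseteq> A"
  using assms(1,2,5)
proof (induction \<F> rule: finite_induct)
  case empty
  then show ?case using assms(4) by simp
next
  case (insert A \<F>)
  show ?case
  proof (rule ccontr)
    assume none: "\<not> (\<exists>A\<in>insert A \<F>. P \<subseteq> A)"
    then obtain x where x: "x \<in> P" "x \<notin> A" by blast
    have "\<not> P \<subseteq> \<Union>\<F>" using none insert.IH insert.prems(1) by blast
    then obtain y where y: "y \<in> P" "y \<notin> \<Union>\<F>" by blast
    with insert.prems(2) have yA: "y \<in> A" by blast
    define p where "p t = (1 - t) *\<^sub>R y + t *\<^sub>R x" for t :: real
    have "\<exists>B\<in>\<F>. p t \<in> B" if t: "t \<in> {0<..1}" for t
    proof -
      have "p t \<in> P" unfolding p_def by (rule convexD[OF assms(3) y(1) x(1)]) (use t in auto)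
      moreover have "p t \<notin> A"
      proof
        assume "p t \<in> A"
        then have "(1 - 1 / t) *\<^sub>R y + (1 / t) *\<^sub>R p t \<in> A"
          using insert.prems(1)[of A] yA by (intro mem_affine) auto
        moreover have "(1 - 1 / t) *\<^sub>R y + (1 / t) *\<^sub>R p t = x"
          using t by (simp add: p_def algebra_simps diff_divide_distrib)
        ultimately show False using x(2) by simp
      qed
      ultimately show ?thesis using insert.prems(2) by blast
    qed
    then obtain B where B: "\<And>t. t \<in> {0<..1} \<Longrightarrow> B t \<in> \<F> \<and> p t \<in> B t" by metis
    have "\<not> inj_on B {0<..1::real}"
    proof
      assume "inj_on B {0<..1::real}"
      moreover have "B ` {0<..1} \<subseteq> \<F>" using B by blast
      ultimately have "finite {0<..1::real}" using insert.hyps(1) by (metis inj_on_finite)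
      then show False by (simp add: infinite_Ioc)
    qed
    then obtain s t where st: "s \<in> {0<..1}" "t \<in> {0<..1}" "s \<noteq> t" "B s = B t"
      unfolding inj_on_def by blast
    \<comment> \<open>The weights with which \<open>p s\<close> and \<open>p t\<close> combine to the endpoint \<open>y = p 0\<close>.\<close>
    define a b where "a = t / (t - s)" and "b = - s / (t - s)"
    have ab: "a + b = 1" "a * s + b * t = 0"
      using st(3) by (simp_all add: a_def b_def diff_divide_distrib[symmetric])
    have "a *\<^sub>R p s + b *\<^sub>R p t \<in> B t"
    proof (rule mem_affine)
      show "affine (B t)" "p s \<in> B t" "p t \<in> B t"
        using B[OF st(1)] B[OF st(2)] st(4) insert.prems(1) by auto
    qed (rule ab)
    moreover have "a *\<^sub>R p s + b *\<^sub>R p t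
        = (a + b) *\<^sub>R y + (a * s + b * t) *\<^sub>R (x - y)"
      unfolding p_def by (simp add: algebra_simps)
    then have "a *\<^sub>R p s + b *\<^sub>R p t = y" unfolding ab by simp
    ultimately show False using y(2) B[OF st(2)] by auto
  qed
qed

lemma polyhedral_set_imp_convex: "polyhedral_set P \<Longrightarrow> convex P"
proof -
  assume "polyhedral_set P"
  then obtain H where P: "P = \<Inter>H"
    and H: "\<And>h. h \<in> H \<Longrightarrow> \<exists>(l :: 'a \<Rightarrow> real) b. linear l \<and> h = {x. l x \<le> b}"
    unfolding polyhedral_set_def by blast
  have "convex {x. l x \<le> b}" if "linear l" for l :: "'a \<Rightarrow> real" and b
  proof -
    have "convex (l -` {..b})" using that by (intro convex_linear_vimage) auto
    then show ?thesis by (simp add: vimage_def)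
  qed
  then show "convex P" unfolding P using H by (intro convex_Inter) metis
qed

text \<open>The type of a single point \<open>X0\<close> of \<open>P\<close> imposes its equations on all of \<open>P\<close>. Hence rows covered by
  the same column at \<open>X0\<close> always belong to the same block, and representatives of the blocks,
  together with columns covering them at \<open>X0\<close>, select a non-singular submatrix.\<close>

lemma nonsingular_of_convex_subset:
  fixes M :: "real ^ 'n ^ 'd"
  assumes "convex P" "P \<noteq> {}" and hull: "P \<subseteq> trop_hull (\<lambda>j. column j M)"
  obtains r and f :: "nat \<Rightarrow> 'd" and g :: "nat \<Rightarrow> 'n" where "inj_on f {..<r}" "inj_on g {..<r}"
    "\<not> trop_singular r (\<lambda>i k. M $ f i $ g k)" "affine_dimension P + 1 \<le> r"
proof -
  define A where "A G = {X. \<forall>j. \<forall>i\<in>G j. \<forall>i'\<in>G j. coord_diff i i' X = M $ i $ j - M $ i' $ j}"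
    for G :: "'n \<Rightarrow> 'd set"
  have in_A: "X \<in> A (covers M X)" for X
  proof -
    have "coord_diff i i' X = M $ i $ j - M $ i' $ j"
      if "i \<in> covers M X j" "i' \<in> covers M X j" for i i' j
    proof -
      have "coord_diff i' i X \<le> M $ i' $ j - M $ i $ j" "coord_diff i i' X \<le> M $ i $ j - M $ i' $ j"
        using that unfolding covers_def by auto
      moreover have "coord_diff i i' X = - coord_diff i' i X" by transfer simp
      ultimately show ?thesis by linarith
    qed
    then show ?thesis unfolding A_def by blast
  qed
  have affA: "affine (A G)" for G
    unfolding affine_def A_def
    by (auto simp: coord_diff_simps distrib_right[symmetric])
  have "\<exists>B\<in>(\<lambda>X. A (covers M X)) ` P. P \<subseteq> B"
  proof (rule convex_subset_of_finite_affine_cover)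
    have "(\<lambda>X. A (covers M X)) ` P \<subseteq> range A" by blast
    then show "finite ((\<lambda>X. A (covers M X)) ` P)" by (rule finite_subset) simp
    show "P \<subseteq> \<Union> ((\<lambda>X. A (covers M X)) ` P)" using in_A by blast
  qed (use affA assms in auto)
  then obtain X0 where X0: "X0 \<in> P" "P \<subseteq> A (covers M X0)" by blast
  \<comment> \<open>The block of \<open>i\<close>; as sets of rows, blocks serve as their own labels.\<close>
  define E where "E i = {i'. \<forall>X\<in>P. \<forall>Y\<in>P. coord_diff i i' X = coord_diff i i' Y}" for i
  have E_iff: "E i = E i' \<longleftrightarrow> i' \<in> E i" for i i'
  proof
    show "E i = E i'" if "i' \<in> E i"
    proof -
      have "coord_diff i k X = coord_diff i k Y \<longleftrightarrow> coord_diff i' k X = coord_diff i' k Y"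
        if "X \<in> P" "Y \<in> P" for k X Y
      proof -
        have "coord_diff i i' X = coord_diff i i' Y" using that \<open>i' \<in> E i\<close> unfolding E_def by blast
        then show ?thesis
          using coord_diff_trans[of i i' X k] coord_diff_trans[of i i' Y k] by linarith
      qed
      then show ?thesis unfolding E_def by blast
    qed
    have "i' \<in> E i'" by (simp add: E_def)
    then show "i' \<in> E i" if "E i = E i'" using that by simp
  qed
  have same: "E i = E i'" if "i \<in> covers M X0 j" "i' \<in> covers M X0 j" for i i' j
  proof -
    have "coord_diff i i' X = M $ i $ j - M $ i' $ j" if "X \<in> P" for X
      using X0(2) that \<open>i \<in> _\<close> \<open>i' \<in> _\<close> unfolding A_def by blast
    then show ?thesis unfolding E_iff by (simp add: E_def)
  qed
  define r where "r = card (range E)"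
  obtain q where q: "bij_betw q {..<r} (range E)"
    using ex_bij_betw_nat_finite[of "range E"] unfolding r_def atLeast0LessThan by auto
  have q_range: "q k \<in> range E" if "k < r" for k using q that bij_betwE by blast
  define f where "f k = inv E (q k)" for k
  have Ef: "E (f k) = q k" if "k < r" for k
    unfolding f_def using q_range[OF that] by (rule f_inv_into_f)
  have "\<exists>j. f k \<in> covers M X0 j" for k using hull X0(1) mem_trop_hull_iff by blast
  then obtain g where g: "\<And>k. f k \<in> covers M X0 (g k)" by metis
  have distinct: "i = k" if "i < r" "k < r" "f i \<in> covers M X0 (g k)" for i k
    using same[OF that(3) g] Ef that(1,2) q by (metis bij_betw_imp_inj_on inj_on_def lessThan_iff)
  have "inj_on f {..<r}" using distinct g by (intro inj_onI) (metis lessThan_iff)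
  moreover have "inj_on g {..<r}" using distinct g by (intro inj_onI) (metis lessThan_iff)
  moreover obtain i0 :: 'd where True by blast
  \<comment> \<open>The least coefficient of column \<open>g k\<close> at \<open>X0\<close>, for the representative that vanishes at \<open>i0\<close>.\<close>
  define c where "c k = coord_diff (f k) i0 X0 - M $ f k $ g k" for k
  have "\<not> trop_singular r (\<lambda>i k. M $ f i $ g k)"
  proof (rule not_trop_singular_of_potential)
    fix i k assume ik: "i < r" "k < r" "i \<noteq> k"
    have le: "coord_diff i' (f k) X0 \<le> M $ i' $ g k - M $ f k $ g k" for i'
      using g[of k] unfolding covers_def by blast
    have "coord_diff (f i) (f k) X0 \<noteq> M $ f i $ g k - M $ f k $ g k"
    proof
      assume eq: "coord_diff (f i) (f k) X0 = M $ f i $ g k - M $ f k $ g k"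
      have "coord_diff i' (f i) X0 \<le> M $ i' $ g k - M $ f i $ g k" for i'
        using le[of i'] eq coord_diff_trans[of i' "f i" X0 "f k"] by linarith
      then have "f i \<in> covers M X0 (g k)" unfolding covers_def by blast
      then show False using distinct ik by blast
    qed
    then have "coord_diff (f i) (f k) X0 < M $ f i $ g k - M $ f k $ g k"
      using le[of "f i"] by simp
    then show "c i + M $ f i $ g i < c k + M $ f i $ g k"
      using coord_diff_trans[of "f i" "f k" X0 i0] by (simp add: c_def)
  qed
  moreover have "affine_dimension P + 1 \<le> r"
  proof -
    obtain B where B: "finite B" "span B = block_space E" "card B + 1 = card (range E)"
      by (rule block_space_basis[of E])
    have "{X - Y |X Y. X \<in> P \<and> Y \<in> P} \<subseteq> span B"
    proof
      fix Z assume "Z \<in> {X - Y |X Y. X \<in> P \<and> Y \<in> P}"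
      then obtain X Y where Z: "Z = X - Y" "X \<in> P" "Y \<in> P" by blast
      have "coord_diff i i' Z = 0" if "E i = E i'" for i i'
      proof -
        have "i' \<in> E i" using that by (rule E_iff[THEN iffD1])
        then have "coord_diff i i' X = coord_diff i i' Y" using Z(2,3) unfolding E_def by blast
        then show ?thesis by (simp add: Z(1) coord_diff_simps)
      qed
      then show "Z \<in> span B" unfolding B(2) block_space_def by blast
    qed
    from real_vector.dim_le_card[OF this B(1)] show ?thesis
      using B(3) unfolding affine_dimension_def r_def by linarith
  qed
  ultimately show ?thesis using that by blast
qed

theorem theorem4p2:
  fixes M :: "real ^ 'n ^ 'd"
  shows "trop_rank M = 1 + polyhedral_dim (trop_hull (\<lambda>j. column j M))"
proof -
  define R where "R = {r. \<exists>(f :: nat \<Rightarrow> 'd) (g :: nat \<Rightarrow> 'n).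
     inj_on f {..<r} \<and> inj_on g {..<r} \<and> \<not> trop_singular r (\<lambda>i k. M $ f i $ g k)}"
  define D where "D = {affine_dimension P |P. polyhedral_set P \<and> P \<noteq> {} \<and>
     P \<subseteq> trop_hull (\<lambda>j. column j M)}"
  have rank: "trop_rank M = Max R" and dim: "polyhedral_dim (trop_hull (\<lambda>j. column j M)) = Max D"
    by (simp_all add: trop_rank_def polyhedral_dim_def R_def D_def)
  have finR: "finite R"
  proof (rule finite_subset)
    have "r \<le> CARD('d)" if "inj_on f {..<r}" for r and f :: "nat \<Rightarrow> 'd"
      using card_inj_on_le[OF that, of UNIV] by simp
    then show "R \<subseteq> {..CARD('d)}" unfolding R_def by blast
  qed simp
  have "\<not> trop_singular 1 A" for A by (rule not_trop_singular_of_potential) simp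
  then have "1 \<in> R" unfolding R_def by (simp add: inj_on_def)
  then have neR: "R \<noteq> {}" and pos: "1 \<le> Max R" using finR by auto
  have upper: "x + 1 \<le> Max R" if "x \<in> D" for x
  proof -
    from that obtain P where P: "x = affine_dimension P" "polyhedral_set P" "P \<noteq> {}"
      "P \<subseteq> trop_hull (\<lambda>j. column j M)" unfolding D_def by blast
    obtain r and f :: "nat \<Rightarrow> 'd" and g :: "nat \<Rightarrow> 'n" where
      "inj_on f {..<r}" "inj_on g {..<r}"
      "\<not> trop_singular r (\<lambda>i k. M $ f i $ g k)" "affine_dimension P + 1 \<le> r"
      by (rule nonsingular_of_convex_subset[OF polyhedral_set_imp_convex[OF P(2)] P(3,4)])
    then have "r \<in> R" "x + 1 \<le> r" unfolding R_def P(1) by blast+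
    then show ?thesis using Max_ge[OF finR] order_trans by blast
  qed
  have "Max R \<in> R" by (rule Max_in[OF finR neR])
  then obtain f :: "nat \<Rightarrow> 'd" and g :: "nat \<Rightarrow> 'n"
    where "\<not> trop_singular (Max R) (\<lambda>i k. M $ f i $ g k)"
    by (subst (asm) (2) R_def) blast
  moreover have "0 < Max R" using pos by simp
  ultimately obtain P where "polyhedral_set P" "P \<noteq> {}" "P \<subseteq> trop_hull (\<lambda>j. column j M)"
    "affine_dimension P + 1 = Max R" by (rule polyhedral_subset_of_nonsingular)
  then obtain x where x: "x \<in> D" "x + 1 = Max R" unfolding D_def by blast
  have "Max D = x"
  proof (rule Max_eqI)
    have "D \<subseteq> {..Max R}" using upper by force
    then show "finite D" by (rule finite_subset) simp
    show "y \<le> x" if "y \<in> D" for y using upper[OF that] x(2) by simp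
  qed (rule x(1))
  then show ?thesis unfolding rank dim using x(2) by simp
qed

end
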